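(* For any signature $S$ and any set $X$ of positive integers, the map $\mathrm{tlt}(X):T(S)\to T(S)$ is a closure operator of the poset $(T(S),\preceq)$, i.e. (1) $t\preceq \mathrm{tlt}(X)(t)$ for all $t$; (2) $t\preceq t'$ implies $\mathrm{tlt}(X)(t)\preceq\mathrm{tlt}(X)(t')$; (3) $\mathrm{tlt}(X)(\mathrm{tlt}(X)(t))=\mathrm{tlt}(X)(t)$ for all $t$.
   Context: A signature is a set $S$ with an arity map $|\cdot|:S\to\mathbb N$. An $S$-term is either the leaf $\ell$ or a tuple $s\,t_1\cdots t_{|s|}$ with $s\in S$ and $t_1,\dots,t_{|s|}$ $S$-terms (an ordered rooted tree whose internal nodes having $k$ children are decorated by elements of arity $k$); $T(S)$ is the set of $S$-terms. The preorder traversal of $s\,t_1\cdots t_k$ visits the root, then $t_1,\dots,t_k$ from left to right recursively. Internal nodes of $t$ are numbered $1,\dots,\deg t$ in preorder and identified with these numbers; $\mathrm{dc}(t)$ is the word of decorations of the internal nodes in this order. Children of a node (leaves included) are numbered $1,2,\dots$ from left to right. The parent edge of a non-root internal node $i$ is $(\mathrm{pa}(i),\mathrm{lp}(i),i)$ where $i$ is the $\mathrm{lp}(i)$-th child of $\mathrm{pa}(i)$; for the root, by convention $\mathrm{pa}(1)=1$, $\mathrm{lp}(1)=0$. The connection word is $\mathrm{cnc}(t)(i)=\mathrm{pa}(i)+1-2^{\mathrm{lp}(i)-a}$, $a$ being the arity of the decoration of $\mathrm{pa}(i)$. The easterly wind order: $t_1\preceq t_2$ iff $\mathrm{dc}(t_1)=\mathrm{dc}(t_2)$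 and $\mathrm{cnc}(t_1)(i)\le\mathrm{cnc}(t_2)(i)$ for all $i$. For a set $X$ of positive integers, $\mathrm{tlt}(X)(t)$ is the $S$-term obtained from $t$ by rearranging, for every internal node $i\in X$, the children of $i$ so that the non-leaf children keep their original relative order and precede all children that are leaves. *)

theory Defs
  imports Complex_Main "HOL-Library.FuncSet"
begin

datatype 's sterm = Leaf | Node 's "'s sterm list"

inductive_set S_terms :: "'s set \<Rightarrow> ('s \<Rightarrow> nat) \<Rightarrow> 's sterm set"
  for S :: "'s set" and ar :: "'s \<Rightarrow> nat" where
  leaf: "Leaf \<in> S_terms S ar"
| node: "s \<in> S \<Longrightarrow> length ts = ar s \<Longrightarrow> \<forall>t\<in>set ts. t \<in> S_terms S ar
    \<Longrightarrow> Node s ts \<in> S_terms S ar"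

lemma size_enumerate [termination_simp]:
  assumes "(j, t) \<in> set (enumerate n ts)"
  shows "size t < Suc (size_list size ts)"
proof -
  from assms have "t \<in> set ts"
    by (metis in_set_enumerate_eq nth_mem fst_conv snd_conv add_diff_inverse_nat not_less
        less_diff_conv2 add.commute)
  then show ?thesis
    using size_list_estimation'[of t ts "size t" size] by simp
qed

text \<open>A node is addressed by the list of child numbers (starting at 1, leaves counted) on the
  path from the root. The internal nodes are listed in preorder.\<close>

fun internal_nodes :: "'s sterm \<Rightarrow> nat list list" where
  "internal_nodes Leaf = []"
| "internal_nodes (Node s ts) =
     [] # concat (map (\<lambda>(j, t). map ((#) j) (internal_nodes t)) (enumerate 1 ts))"

definition deg :: "'s sterm \<Rightarrow> nat" where
  "deg t = length (internal_nodes t)"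

fun dc :: "'s sterm \<Rightarrow> 's list" where
  "dc Leaf = []"
| "dc (Node s ts) = s # concat (map dc ts)"

text \<open>Address of the internal node numbered \<open>i\<close>; meaningful for \<open>1 \<le> i \<le> deg t\<close>.\<close>

definition addr :: "'s sterm \<Rightarrow> nat \<Rightarrow> nat list" where
  "addr t i = internal_nodes t ! (i - 1)"

definition pa :: "'s sterm \<Rightarrow> nat \<Rightarrow> nat" where
  "pa t i = (if i = 1 then 1 else (THE j. j \<in> {1..deg t} \<and> addr t j = butlast (addr t i)))"

definition lp :: "'s sterm \<Rightarrow> nat \<Rightarrow> nat" where
  "lp t i = (if i = 1 then 0 else last (addr t i))"

text \<open>The exponent is an integer and may be negative.\<close>

definition cnc :: "('s \<Rightarrow> nat) \<Rightarrow> 's sterm \<Rightarrow> nat \<Rightarrow> real" where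
  "cnc ar t i = real (pa t i) + 1 - 2 powi (int (lp t i) - int (ar (dc t ! (pa t i - 1))))"

definition wind_le :: "('s \<Rightarrow> nat) \<Rightarrow> 's sterm \<Rightarrow> 's sterm \<Rightarrow> bool" where
  "wind_le ar t t' \<longleftrightarrow> dc t = dc t' \<and> (\<forall>i\<in>{1..deg t}. cnc ar t i \<le> cnc ar t' i)"

definition leaves_last :: "'s sterm list \<Rightarrow> 's sterm list" where
  "leaves_last ts = filter (\<lambda>t. t \<noteq> Leaf) ts @ filter (\<lambda>t. t = Leaf) ts"

text \<open>Rearrangement at a set \<open>P\<close> of addresses. These are always addresses in the original term:
  the children are treated before they are permuted.\<close>

fun tilt_at :: "nat list set \<Rightarrow> 's sterm \<Rightarrow> 's sterm" where
  "tilt_at P Leaf = Leaf"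
| "tilt_at P (Node s ts) =
     Node s ((if [] \<in> P then leaves_last else id)
       (map (\<lambda>(j, t). tilt_at {p. j # p \<in> P} t) (enumerate 1 ts)))"

definition tlt :: "nat set \<Rightarrow> 's sterm \<Rightarrow> 's sterm" where
  "tlt X t = tilt_at (addr t ` (X \<inter> {1..deg t})) t"

definition poset_on :: "'a set \<Rightarrow> ('a \<Rightarrow> 'a \<Rightarrow> bool) \<Rightarrow> bool" where
  "poset_on A le \<longleftrightarrow> reflp_on A le \<and> antisymp_on A le \<and> transp_on A le"

definition closure_operator_on :: "'a set \<Rightarrow> ('a \<Rightarrow> 'a \<Rightarrow> bool) \<Rightarrow> ('a \<Rightarrow> 'a) \<Rightarrow> bool" where
  "closure_operator_on A le f \<longleftrightarrow>
     f \<in> A \<rightarrow> A \<and>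
     (\<forall>x\<in>A. le x (f x)) \<and>
     monotone_on A le le f \<and>
     (\<forall>x\<in>A. f (f x) = f x)"

end

theory Submission imports Defs
begin

text \<open>Terms with the same decorations are compared by \<open>\<preceq>\<close> through the pairs (parent, local
  position), lexicographically and with the local position reversed, and these pairs determine
  the term; this gives antisymmetry. Tilting at \<open>X\<close> changes neither the preorder numbering nor
  the parents, and replaces the local position of a node whose parent lies in \<open>X\<close> by its rank
  among its non-leaf siblings. This rank is at most the local position, depends on the parents
  only, and can only decrease when the term grows without changing the parent of the node.\<close>

section \<open>Addresses of internal nodes\<close>

lemma sterm_snoc_induct [case_names Leaf Nil snoc]:
  assumes "P Leaf" and "\<And>s. P (Node s [])"
    and "\<And>s ts x. P (Node s ts) \<Longrightarrow> P x \<Longrightarrow> P (Node s (ts @ [x]))"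
  shows "P t"
proof (induction t)
  case (Node s ts)
  then show ?case
    by (induction ts rule: rev_induct) (auto intro: assms)
qed (rule assms)

text \<open>A new last child renumbers no earlier child and its nodes come last in preorder, so the
  list only grows at its end. This is why several inductions over terms go through
  \<open>sterm_snoc_induct\<close>.\<close>

lemma internal_nodes_snoc:
  "internal_nodes (Node s (ts @ [x])) =
     internal_nodes (Node s ts) @ map ((#) (Suc (length ts))) (internal_nodes x)"
  by (simp add: enumerate_append_eq)

lemma internal_nodes_Node:
  "internal_nodes (Node s ts) =
     [] # concat (map (\<lambda>k. map ((#) (Suc k)) (internal_nodes (ts ! k))) [0..<length ts])"
proof (induction ts rule: rev_induct)
  case (snoc x xs)
  then show ?case
    by (auto simp: internal_nodes_snoc nth_append simp del: internal_nodes.simps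
        intro!: arg_cong[where f = concat])
qed simp

lemma in_internal_nodes_Node:
  "a \<in> set (internal_nodes (Node s ts)) \<longleftrightarrow>
     a = [] \<or> (\<exists>k<length ts. \<exists>b\<in>set (internal_nodes (ts ! k)). a = Suc k # b)"
  unfolding internal_nodes_Node by auto

lemma length_dc: "length (dc t) = deg t"
  unfolding deg_def
proof (induction t rule: sterm_snoc_induct)
  case (snoc s ts x)
  then show ?case by (simp only: internal_nodes_snoc) simp
qed simp_all

lemma internal_nodes_eq_Nil_iff [simp]: "internal_nodes t = [] \<longleftrightarrow> t = Leaf"
  by (cases t) auto

lemma Nil_in_internal_nodes_iff [simp]: "[] \<in> set (internal_nodes t) \<longleftrightarrow> t \<noteq> Leaf"
  by (cases t) auto

text \<open>Preorder is the lexicographic order of addresses: a proper prefix (an ancestor) comes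
  first, then smaller child numbers. In the step, the new child number exceeds the head of every
  earlier nonempty address.\<close>

lemma internal_nodes_sorted: "sorted_wrt (\<lambda>a b. (a, b) \<in> lexord less_than) (internal_nodes t)"
proof (induction t rule: sterm_snoc_induct)
  case (snoc s ts x)
  have "(a, Suc (length ts) # b) \<in> lexord less_than"
    if "a \<in> set (internal_nodes (Node s ts))" for a b
    using that unfolding in_internal_nodes_Node by auto
  with snoc show ?case
    unfolding internal_nodes_snoc sorted_wrt_append sorted_wrt_map by auto
qed simp_all

lemma internal_nodes_prefix_closed:
  "a @ b \<in> set (internal_nodes t) \<Longrightarrow> a \<in> set (internal_nodes t)"
proof (induction t arbitrary: a)
  case (Node s ts)
  show ?case
  proof (cases a)
    case (Cons j a')
    with Node show ?thesis
      unfolding in_internal_nodes_Node by auto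
  qed simp
qed simp

lemma internal_nodes_pos:
  "a @ [j] \<in> set (internal_nodes t) \<Longrightarrow> 0 < j"
proof (induction t arbitrary: a)
  case (Node s ts)
  then show ?case
    unfolding in_internal_nodes_Node by (cases a) (auto, metis nth_mem)
qed simp

section \<open>Preorder numbers versus lexicographic order\<close>

lemma lexord_less_than_irrefl: "(a, a) \<notin> lexord less_than"
  by (simp add: lexord_irreflexive)

lemma lexord_less_than_asym:
  "(a, b) \<in> lexord less_than \<Longrightarrow> (b, a) \<notin> lexord less_than"
  by (metis lexord_less_than_irrefl lexord_trans trans_less_than)

lemma addr_less:
  assumes "i \<in> {1..deg t}" "j \<in> {1..deg t}" "i < j"
  shows "(addr t i, addr t j) \<in> lexord less_than"
  using sorted_wrt_nth_less[OF internal_nodes_sorted, of "i - 1" "j - 1" t] assms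
  unfolding addr_def deg_def by auto

lemma addr_less_iff:
  assumes "i \<in> {1..deg t}" "j \<in> {1..deg t}"
  shows "(addr t i, addr t j) \<in> lexord less_than \<longleftrightarrow> i < j"
  using addr_less[OF assms] addr_less[OF assms(2,1)] lexord_less_than_asym lexord_less_than_irrefl
  by (metis linorder_neqE_nat)

lemma addr_inj:
  assumes "i \<in> {1..deg t}" "j \<in> {1..deg t}" "addr t i = addr t j"
  shows "i = j"
  using addr_less_iff assms lexord_less_than_irrefl by (metis linorder_neqE_nat)

lemma inj_on_addr: "inj_on (addr t) {1..deg t}"
  by (rule inj_onI) (rule addr_inj)

lemma addr_in: "i \<in> {1..deg t} \<Longrightarrow> addr t i \<in> set (internal_nodes t)"
  unfolding addr_def deg_def by (auto intro!: nth_mem)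

lemma addr_surj:
  assumes "a \<in> set (internal_nodes t)"
  obtains i where "i \<in> {1..deg t}" "addr t i = a"
proof -
  from assms obtain k where "k < deg t" "internal_nodes t ! k = a"
    unfolding deg_def by (auto simp: in_set_conv_nth)
  then show ?thesis using that[of "Suc k"] by (simp add: addr_def)
qed

lemma addr_root: "0 < deg t \<Longrightarrow> addr t 1 = []"
  unfolding addr_def deg_def by (cases t) auto

lemma addr_nonroot:
  assumes "i \<in> {2..deg t}"
  shows "addr t i \<noteq> []"
  using addr_inj[of i t 1] addr_root[of t] assms by force

section \<open>Parents and local positions\<close>

lemma pa_eqI:
  assumes "i \<in> {2..deg t}" "j \<in> {1..deg t}" "addr t j = butlast (addr t i)"
  shows "pa t i = j"
proof -
  have "(THE j. j \<in> {1..deg t} \<and> addr t j = butlast (addr t i)) = j"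
  proof (rule the_equality)
    fix k assume k: "k \<in> {1..deg t} \<and> addr t k = butlast (addr t i)"
    show "k = j" by (rule addr_inj[of _ t]) (simp_all only: k assms)
  qed (simp only: assms)
  with assms(1) show ?thesis by (simp add: pa_def)
qed

lemma addr_pa:
  assumes "i \<in> {2..deg t}"
  shows "pa t i \<in> {1..deg t}" and "addr t i = addr t (pa t i) @ [lp t i]"
proof -
  have ne: "addr t i \<noteq> []" by (rule addr_nonroot[OF assms])
  have "addr t i \<in> set (internal_nodes t)" using addr_in[of i t] assms by simp
  \<comment> \<open>Prefix closure supplies the node that the definite description in
    \<open>pa\<close> picks out.\<close>
  then have "butlast (addr t i) \<in> set (internal_nodes t)"
    using internal_nodes_prefix_closed append_butlast_last_id[OF ne] by metis
  then obtain j where j: "j \<in> {1..deg t}" "addr t j = butlast (addr t i)"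
    by (rule addr_surj)
  then have "pa t i = j" using pa_eqI assms by blast
  with j ne assms show "pa t i \<in> {1..deg t}" "addr t i = addr t (pa t i) @ [lp t i]"
    by (auto simp: lp_def)
qed

lemma pa_less:
  assumes "i \<in> {2..deg t}"
  shows "pa t i < i"
proof -
  have "(addr t (pa t i), addr t i) \<in> lexord less_than"
    by (subst addr_pa(2)[OF assms]) (simp add: lexord_append_rightI)
  then show ?thesis using addr_less_iff[of "pa t i" t i] addr_pa(1)[OF assms] assms by simp
qed

text \<open>A disagreement of \<open>b\<close> with \<open>a\<close> at a position inside
  \<open>a\<close> would put \<open>b\<close> either below \<open>a\<close> or above every extension
  of \<open>a\<close>.\<close>

lemma lexord_between_child:
  assumes "(a, b) \<in> lexord less_than" "b = a @ [l] \<or> (b, a @ [l]) \<in> lexord less_than"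
  shows "\<exists>c. c \<noteq> [] \<and> b = a @ c"
  using assms
proof (induction a arbitrary: b)
  case Nil
  then show ?case by (cases b) auto
next
  case (Cons x a)
  then show ?case by (cases b) auto
qed

text \<open>In preorder the descendants of \<open>pa t i\<close> form an interval that contains \<open>i\<close>.\<close>

lemma pa_le_between:
  assumes "i \<in> {2..deg t}" "pa t i < j" "j \<le> i"
  shows "pa t i \<le> pa t j"
proof (rule ccontr)
  assume less: "\<not> pa t i \<le> pa t j"
  have j: "j \<in> {2..deg t}" using assms addr_pa(1)[OF assms(1)] by auto
  have "(addr t (pa t i), addr t j) \<in> lexord less_than"
    using addr_less[of "pa t i" t j] addr_pa(1)[OF assms(1)] j assms(2) by simp
  moreover have "addr t j = addr t i \<or> (addr t j, addr t i) \<in> lexord less_than"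
    using addr_less[of j t i] assms j by (cases "j = i") auto
  ultimately obtain c where c: "c \<noteq> []" "addr t j = addr t (pa t i) @ c"
    using lexord_between_child addr_pa(2)[OF assms(1)] by metis
  \<comment> \<open>As \<open>c\<close> is nonempty, the parent of \<open>j\<close> is
    \<open>pa t i\<close> or one of its descendants, so it cannot precede \<open>pa t i\<close> in
    preorder.\<close>
  then have "addr t (pa t j) = addr t (pa t i) @ butlast c"
    using addr_pa(2)[OF j] by (metis butlast_append butlast_snoc)
  moreover have "(addr t (pa t j), addr t (pa t i)) \<in> lexord less_than"
    using addr_less[of "pa t j" t "pa t i"] addr_pa(1)[OF assms(1)] addr_pa(1)[OF j] less by simp
  ultimately show False
    by (metis append_Nil2 lexord_append_rightI lexord_less_than_asym lexord_less_than_irrefl neq_Nil_conv)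
qed

section \<open>Ranks among non-leaf siblings\<close>

text \<open>The range starts at 2 because the convention \<open>pa t 1 = 1\<close> would otherwise
  make the root a child of itself.\<close>

definition sibling_rank :: "'s sterm \<Rightarrow> nat \<Rightarrow> nat" where
  "sibling_rank t i = card {j \<in> {2..i}. pa t j = pa t i}"

text \<open>Links the count of occupied child slots, which describes tilting on addresses, to the
  count of node numbers. Siblings appear in preorder by increasing local position, so
  \<open>lp t\<close> is a bijection between the two sets.\<close>

lemma card_older_siblings:
  assumes i: "i \<in> {2..deg t}"
  shows "card {l. l \<le> lp t i \<and> addr t (pa t i) @ [l] \<in> set (internal_nodes t)} = sibling_rank t i"
proof -
  let ?A = "{j \<in> {2..i}. pa t j = pa t i}"
  let ?B = "{l. l \<le> lp t i \<and> addr t (pa t i) @ [l] \<in> set (internal_nodes t)}"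
  have eq: "addr t j = addr t (pa t i) @ [lp t j]" if "j \<in> ?A" for j
    using addr_pa(2)[of j t] that i by auto
  have "inj_on (lp t) ?A"
  proof (rule inj_onI)
    fix j k assume "j \<in> ?A" "k \<in> ?A" "lp t j = lp t k"
    then show "j = k" using eq addr_inj[of j t k] i by auto
  qed
  moreover have "lp t ` ?A = ?B"
  proof
    show "lp t ` ?A \<subseteq> ?B"
    proof
      fix l assume "l \<in> lp t ` ?A"
      then obtain j where j: "2 \<le> j" "j \<le> i" "pa t j = pa t i" "l = lp t j" by auto
      then have "addr t j \<in> set (internal_nodes t)" using addr_in[of j t] i by simp
      moreover have "lp t j \<le> lp t i"
      proof (cases "j = i")
        case False
        then have "(addr t j, addr t i) \<in> lexord less_than" using addr_less[of j t i] j i by simp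
        then have "(addr t (pa t i) @ [lp t j], addr t (pa t i) @ [lp t i]) \<in> lexord less_than"
          using eq[of j] eq[of i] j i by auto
        then show ?thesis by (simp add: lexord_same_pref_iff)
      qed simp
      ultimately show "l \<in> ?B"
        using eq[of j] j by simp
    qed
    show "?B \<subseteq> lp t ` ?A"
    proof
      fix l assume l: "l \<in> ?B"
      then obtain j where j: "j \<in> {1..deg t}" "addr t j = addr t (pa t i) @ [l]"
        using addr_surj by blast
      have "j \<noteq> 1" using j addr_root[of t] by auto
      then have j2: "j \<in> {2..deg t}" using j by auto
      have pj: "pa t j = pa t i"
        by (rule pa_eqI[OF j2]) (use j addr_pa[OF i] in auto)
      have lj: "lp t j = l" using addr_pa(2)[OF j2] j by simp
      have "\<not> i < j"
      proof
        assume "i < j"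
        then have "(addr t i, addr t j) \<in> lexord less_than" using addr_less[of i t j] i j by simp
        then have "lp t i < l"
          by (subst (asm) addr_pa(2)[OF i]) (simp add: j lexord_same_pref_iff)
        with l show False by simp
      qed
      with pj lj j2 show "l \<in> lp t ` ?A" by auto
    qed
  qed
  ultimately show ?thesis
    using card_image[of "lp t" ?A] by (simp only: sibling_rank_def)
qed

text \<open>The slots counted by the rank are distinct and positive, and none exceeds
  \<open>lp t i\<close>.\<close>

lemma sibling_rank_le_lp:
  assumes "i \<in> {2..deg t}"
  shows "sibling_rank t i \<le> lp t i"
proof -
  have "{l. l \<le> lp t i \<and> addr t (pa t i) @ [l] \<in> set (internal_nodes t)} \<subseteq> {1..lp t i}"
    using internal_nodes_pos by fastforce
  from card_mono[OF _ this] show ?thesis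
    by (simp add: card_older_siblings[OF assms])
qed

section \<open>The effect of tilting on addresses, parents and positions\<close>

text \<open>\<open>tilt_address P N a\<close> is the address after \<open>tilt_at P\<close> of the internal node with address
  \<open>a\<close>, in a term whose internal nodes have the addresses \<open>N\<close>.\<close>

fun tilt_address :: "nat list set \<Rightarrow> nat list set \<Rightarrow> nat list \<Rightarrow> nat list" where
  "tilt_address P N [] = []"
| "tilt_address P N (j # a) =
     (if [] \<in> P then card {l. l \<le> j \<and> [l] \<in> N} else j)
       # tilt_address {p. j # p \<in> P} {p. j # p \<in> N} a"

text \<open>The image of an address extends the image of the parent's address by one entry; hence
  tilting preserves parents.\<close>

lemma tilt_address_snoc:
  "tilt_address P N (a @ [j]) =
     tilt_address P N a @ [if a \<in> P then card {l. l \<le> j \<and> a @ [l] \<in> N} else j]"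
  by (induction a arbitrary: P N) auto

lemma internal_nodes_leaves_last:
  "internal_nodes (Node s (leaves_last us)) =
     [] # concat (map (\<lambda>k. map ((#) (length (filter (\<lambda>t. t \<noteq> Leaf) (take (Suc k) us))))
       (internal_nodes (us ! k))) [0..<length us])"
proof -
  have leaves: "internal_nodes (Node s (xs @ ys)) = internal_nodes (Node s xs)"
    if "\<forall>y\<in>set ys. y = Leaf" for xs ys :: "'a sterm list"
    using that
  proof (induction ys rule: rev_induct)
    case (snoc y ys)
    then show ?case
      using internal_nodes_snoc[of s "xs @ ys" y] by (simp del: internal_nodes.simps(2))
  qed simp
  have "internal_nodes (Node s (filter (\<lambda>t. t \<noteq> Leaf) us)) =
     [] # concat (map (\<lambda>k. map ((#) (length (filter (\<lambda>t. t \<noteq> Leaf) (take (Suc k) us))))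
       (internal_nodes (us ! k))) [0..<length us])"
  proof (induction us rule: rev_induct)
    case (snoc x xs)
    then show ?case
      by (cases "x = Leaf")
        (auto simp: internal_nodes_snoc nth_append simp del: internal_nodes.simps(2)
          intro!: arg_cong[where f = concat])
  qed simp
  then show ?thesis
    unfolding leaves_last_def by (subst leaves) auto
qed

lemma tilt_at_eq_Leaf_iff [simp]: "tilt_at P t = Leaf \<longleftrightarrow> t = Leaf"
  by (cases t) auto

text \<open>Non-leaf children keep their order, so the equality holds for lists and not merely for
  sets: a node keeps its preorder number.\<close>

lemma internal_nodes_tilt_at:
  "internal_nodes (tilt_at P t) = map (tilt_address P (set (internal_nodes t))) (internal_nodes t)"
proof (induction t arbitrary: P)
  case (Node s ts)
  define us where "us = map (\<lambda>(j, t). tilt_at {p. j # p \<in> P} t) (enumerate 1 ts)"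
  let ?N = "set (internal_nodes (Node s ts))"
  have len: "length us = length ts" by (simp add: us_def)
  have nth: "us ! k = tilt_at {p. Suc k # p \<in> P} (ts ! k)" if "k < length ts" for k
    using that by (simp add: us_def nth_enumerate_eq)
  have N: "{p. Suc k # p \<in> ?N} = set (internal_nodes (ts ! k))" if "k < length ts" for k
    using that unfolding in_internal_nodes_Node by auto
  have nodes: "internal_nodes (us ! k) =
      map (tilt_address {p. Suc k # p \<in> P} {p. Suc k # p \<in> ?N}) (internal_nodes (ts ! k))"
    if "k < length ts" for k
    using Node that by (simp add: nth N del: internal_nodes.simps)
  have rank: "length (filter (\<lambda>t. t \<noteq> Leaf) (take (Suc k) us)) = card {l. l \<le> Suc k \<and> [l] \<in> ?N}"
    if "k < length ts" for k
  proof -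
    \<comment> \<open>Tilting turns no child into a leaf or out of one, so occupied slots can be
      read off \<open>us\<close> as well as \<open>ts\<close>. The \<open>Suc\<close> passes from
      list indices to child numbers.\<close>
    have "{l. l \<le> Suc k \<and> [l] \<in> ?N} = Suc ` {i. i < Suc k \<and> us ! i \<noteq> Leaf}"
      using that unfolding in_internal_nodes_Node by (auto simp: nth)
    moreover have "{i. i < length (take (Suc k) us) \<and> take (Suc k) us ! i \<noteq> Leaf} =
        {i. i < Suc k \<and> us ! i \<noteq> Leaf}"
      using that len by auto
    ultimately show ?thesis
      by (simp add: length_filter_conv_card card_image)
  qed
  show ?case
  proof (cases "[] \<in> P")
    case True
    then have "internal_nodes (tilt_at P (Node s ts)) = internal_nodes (Node s (leaves_last us))"
      by (simp add: us_def)
    also have "\<dots> = [] # concat (map (\<lambda>k. map (tilt_address P ?N \<circ> (#) (Suc k))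
        (internal_nodes (ts ! k))) [0..<length ts])"
      unfolding internal_nodes_leaves_last len
      using True by (auto intro!: arg_cong[where f = concat] simp: rank nodes simp del: internal_nodes.simps)
    also have "\<dots> = map (tilt_address P ?N) (internal_nodes (Node s ts))"
      by (subst (3) internal_nodes_Node) (simp add: map_concat comp_def)
    finally show ?thesis .
  next
    case False
    then have "internal_nodes (tilt_at P (Node s ts)) = internal_nodes (Node s us)"
      by (simp add: us_def)
    also have "\<dots> = [] # concat (map (\<lambda>k. map (tilt_address P ?N \<circ> (#) (Suc k))
        (internal_nodes (ts ! k))) [0..<length ts])"
      unfolding internal_nodes_Node[of s us] len
      using False by (auto intro!: arg_cong[where f = concat] simp: nodes simp del: internal_nodes.simps)
    also have "\<dots> = map (tilt_address P ?N) (internal_nodes (Node s ts))"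
      by (subst (3) internal_nodes_Node) (simp add: map_concat comp_def)
    finally show ?thesis .
  qed
qed simp

lemma dc_leaves_last: "concat (map dc (leaves_last ts)) = concat (map dc ts)"
proof -
  have "concat (map dc (filter (\<lambda>t. t = Leaf) ts)) = []"
    by (induction ts) auto
  moreover have "concat (map dc (filter (\<lambda>t. t \<noteq> Leaf) ts)) = concat (map dc ts)"
    by (induction ts) auto
  ultimately show ?thesis by (simp add: leaves_last_def)
qed

lemma dc_tilt_at: "dc (tilt_at P t) = dc t"
proof (induction t arbitrary: P)
  case (Node s ts)
  have "map dc (map (\<lambda>(j, t). tilt_at {p. j # p \<in> P} t) (enumerate 1 ts)) = map dc ts"
    using Node by (intro nth_equalityI) (auto simp: nth_enumerate_eq)
  then show ?case by (simp add: dc_leaves_last del: map_map)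
qed simp

lemma length_leaves_last: "length (leaves_last ts) = length ts"
  using sum_length_filter_compl[of "\<lambda>t. t \<noteq> Leaf" ts] by (simp add: leaves_last_def)

lemma set_leaves_last: "set (leaves_last ts) = set ts"
  by (auto simp: leaves_last_def)

lemma Node_in_S_terms_iff:
  "Node s ts \<in> S_terms S ar \<longleftrightarrow> s \<in> S \<and> length ts = ar s \<and> (\<forall>t\<in>set ts. t \<in> S_terms S ar)"
  by (subst S_terms.simps) simp

lemma tilt_at_in_S_terms: "t \<in> S_terms S ar \<Longrightarrow> tilt_at P t \<in> S_terms S ar"
proof (induction t arbitrary: P rule: sterm.induct)
  case (Node s ts)
  from Node.prems have "s \<in> S" "length ts = ar s" "\<forall>t\<in>set ts. t \<in> S_terms S ar"
    by (simp_all add: Node_in_S_terms_iff)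
  with Node.IH show ?case
    by (auto simp: Node_in_S_terms_iff length_leaves_last set_leaves_last in_set_enumerate_eq)
qed simp

lemma deg_tlt: "deg (tlt X t) = deg t"
  by (metis dc_tilt_at length_dc tlt_def)

lemma addr_tlt:
  "i \<in> {1..deg t} \<Longrightarrow> addr (tlt X t) i =
     tilt_address (addr t ` (X \<inter> {1..deg t})) (set (internal_nodes t)) (addr t i)"
  unfolding addr_def tlt_def internal_nodes_tilt_at deg_def by auto

lemma pa_lp_tlt:
  assumes i: "i \<in> {2..deg t}"
  shows "pa (tlt X t) i = pa t i"
    and "lp (tlt X t) i = (if pa t i \<in> X then sibling_rank t i else lp t i)"
proof -
  let ?P = "addr t ` (X \<inter> {1..deg t})"
  note p = addr_pa[OF i]
  \<comment> \<open>Distinct nodes have distinct addresses, so passing from numbers to addresses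
    adds no node to \<open>X\<close>.\<close>
  have iff: "addr t (pa t i) \<in> ?P \<longleftrightarrow> pa t i \<in> X"
    using inj_on_image_mem_iff[OF inj_on_addr p(1), of "X \<inter> {1..deg t}"] p(1) by simp
  have "addr (tlt X t) i = tilt_address ?P (set (internal_nodes t)) (addr t (pa t i) @ [lp t i])"
    using addr_tlt[of i t X] i p(2) by simp
  also have "\<dots> = addr (tlt X t) (pa t i) @ [if pa t i \<in> X then sibling_rank t i else lp t i]"
    unfolding tilt_address_snoc iff card_older_siblings[OF i] using addr_tlt[OF p(1)] by simp
  finally have eq: "addr (tlt X t) i =
      addr (tlt X t) (pa t i) @ [if pa t i \<in> X then sibling_rank t i else lp t i]" .
  show "pa (tlt X t) i = pa t i"
    by (rule pa_eqI) (use i p(1) eq in \<open>auto simp: deg_tlt\<close>)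
  show "lp (tlt X t) i = (if pa t i \<in> X then sibling_rank t i else lp t i)"
    using eq i by (simp add: lp_def)
qed

lemma sibling_rank_tlt:
  assumes "i \<in> {2..deg t}"
  shows "sibling_rank (tlt X t) i = sibling_rank t i"
proof -
  have "{j \<in> {2..i}. pa (tlt X t) j = pa (tlt X t) i} = {j \<in> {2..i}. pa t j = pa t i}"
    using pa_lp_tlt(1)[of _ t X] assms by auto
  then show ?thesis by (simp add: sibling_rank_def)
qed

section \<open>Arity bounds and the connection word\<close>

lemma zip_internal_nodes_dc_snoc:
  "zip (internal_nodes (Node s (ts @ [x]))) (dc (Node s (ts @ [x]))) =
     zip (internal_nodes (Node s ts)) (dc (Node s ts)) @
     map (\<lambda>(a, r). (Suc (length ts) # a, r)) (zip (internal_nodes x) (dc x))"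
proof -
  have "dc (Node s (ts @ [x])) = dc (Node s ts) @ dc x" by simp
  moreover have "length (internal_nodes (Node s ts)) = length (dc (Node s ts))"
    using length_dc unfolding deg_def by metis
  ultimately show ?thesis
    by (simp only: internal_nodes_snoc zip_append zip_map1)
qed

lemma in_zip_internal_nodes_dc:
  assumes "(a, r) \<in> set (zip (internal_nodes (Node s ts)) (dc (Node s ts)))"
  shows "a = [] \<and> r = s \<or>
    (\<exists>k<length ts. \<exists>b. a = Suc k # b \<and> (b, r) \<in> set (zip (internal_nodes (ts ! k)) (dc (ts ! k))))"
  using assms
proof (induction ts rule: rev_induct)
  case (snoc x xs)
  from snoc.prems consider "(a, r) \<in> set (zip (internal_nodes (Node s xs)) (dc (Node s xs)))"
    | b where "a = Suc (length xs) # b" "(b, r) \<in> set (zip (internal_nodes x) (dc x))"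
    unfolding zip_internal_nodes_dc_snoc by auto
  then show ?case
  proof cases
    case 1
    from snoc.IH[OF this] show ?thesis
      by (auto simp: nth_append intro: less_SucI)
  qed (auto simp: nth_append)
qed simp

text \<open>Pairing addresses with decorations by \<open>zip\<close> avoids preorder indices, so the
  claim passes to subterms; \<open>lp_le_arity\<close> reinstates the indices.\<close>

lemma child_le_arity:
  assumes "t \<in> S_terms S ar" "(a, s) \<in> set (zip (internal_nodes t) (dc t))"
    and "a @ [j] \<in> set (internal_nodes t)"
  shows "j \<le> ar s"
  using assms
proof (induction t arbitrary: a rule: sterm.induct)
  case (Node r ts)
  from Node.prems(1) have ts: "length ts = ar r" "\<forall>t\<in>set ts. t \<in> S_terms S ar"
    by (simp_all add: Node_in_S_terms_iff)
  from in_zip_internal_nodes_dc[OF Node.prems(2)] show ?case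
  proof (elim disjE exE conjE)
    assume "a = []" "s = r"
    with Node.prems(3) ts show ?thesis
      unfolding in_internal_nodes_Node by auto
  next
    fix k b
    assume k: "k < length ts" "a = Suc k # b"
      "(b, s) \<in> set (zip (internal_nodes (ts ! k)) (dc (ts ! k)))"
    then have "b @ [j] \<in> set (internal_nodes (ts ! k))"
      using Node.prems(3) unfolding in_internal_nodes_Node by auto
    with Node.IH[of "ts ! k" b] k ts show ?thesis by auto
  qed
qed simp

text \<open>Makes the exponent in \<open>cnc\<close> nonpositive.\<close>

lemma lp_le_arity:
  assumes "t \<in> S_terms S ar" "i \<in> {2..deg t}"
  shows "lp t i \<le> ar (dc t ! (pa t i - 1))"
proof (rule child_le_arity[OF assms(1)])
  have "pa t i - 1 < deg t" using addr_pa(1)[OF assms(2)] by auto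
  then show "(addr t (pa t i), dc t ! (pa t i - 1)) \<in> set (zip (internal_nodes t) (dc t))"
    unfolding set_zip addr_def using length_dc[of t] deg_def[of t] by auto
  show "addr t (pa t i) @ [lp t i] \<in> set (internal_nodes t)"
    using addr_in[of i t] addr_pa(2)[OF assms(2)] assms(2) by simp
qed

text \<open>Since \<open>0 < 2 powi (lp - a) \<le> 1\<close>, the connection word encodes the pair of the parent
  and the (reversed) local position lexicographically.\<close>

lemma cnc_le_iff:
  assumes t: "t \<in> S_terms S ar" and t': "t' \<in> S_terms S ar" and dc: "dc t = dc t'"
    and i: "i \<in> {2..deg t}"
  shows "cnc ar t i \<le> cnc ar t' i \<longleftrightarrow>
    pa t i < pa t' i \<or> pa t i = pa t' i \<and> lp t' i \<le> lp t i"
proof -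
  have i': "i \<in> {2..deg t'}" using i dc length_dc by metis
  have bounds: "0 < (2::real) powi (int l - int a) \<and> (2::real) powi (int l - int a) \<le> 1"
    if "l \<le> a" for l a :: nat
    using that power_int_increasing[of "int l - int a" 0 "2::real"] by simp
  note b = bounds[OF lp_le_arity[OF t i]] bounds[OF lp_le_arity[OF t' i']]
  \<comment> \<open>Each value of \<open>cnc\<close> lies in the half-open interval from its parent
    number to the next integer, so different parents decide the comparison.\<close>
  have less: "cnc ar t i < cnc ar t' i" if "pa t i < pa t' i"
    using b that unfolding cnc_def by linarith
  have greater: "cnc ar t' i < cnc ar t i" if "pa t' i < pa t i"
    using b that unfolding cnc_def by linarith
  \<comment> \<open>Equal parents carry equal decorations, hence equal arities; the power is
    subtracted, which reverses the order of positions.\<close>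
  have "cnc ar t i \<le> cnc ar t' i \<longleftrightarrow> lp t' i \<le> lp t i" if "pa t i = pa t' i"
  proof -
    have "(2::real) powi x \<le> 2 powi y \<longleftrightarrow> x \<le> y" for x y :: int
      using power_int_increasing[of x y "2::real"] power_int_strict_increasing[of y x "2::real"]
      by force
    then show ?thesis unfolding cnc_def that dc by simp
  qed
  with less greater show ?thesis
    by (metis linorder_neqE_nat not_le less_imp_le)
qed

text \<open>The root can be left out: its conventional parent and position, with equal decorations,
  give the same entry in both terms.\<close>

lemma wind_le_iff:
  assumes t: "t \<in> S_terms S ar" and t': "t' \<in> S_terms S ar"
  shows "wind_le ar t t' \<longleftrightarrow> dc t = dc t' \<and>
    (\<forall>i\<in>{2..deg t}. pa t i < pa t' i \<or> pa t i = pa t' i \<and> lp t' i \<le> lp t i)"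
proof -
  have "cnc ar t 1 = cnc ar t' 1" if "dc t = dc t'"
    using that by (simp add: cnc_def pa_def lp_def)
  moreover have "{1..deg t} \<subseteq> insert 1 {2..deg t}" "{2..deg t} \<subseteq> {1..deg t}" by auto
  ultimately show ?thesis
    unfolding wind_le_def using cnc_le_iff[OF assms]
    by (metis (no_types, lifting) insertE order_refl subsetD)
qed

section \<open>Reconstruction of a term and antisymmetry\<close>

text \<open>Addresses do not record leaves; the arity of each decoration tells how many children
  there are, and the unoccupied slots are the leaves.\<close>

lemma sterm_eq_if_internal_nodes_eq:
  assumes "t \<in> S_terms S ar" "t' \<in> S_terms S ar" "dc t = dc t'"
    and "internal_nodes t = internal_nodes t'"
  shows "t = t'"
  using assms
proof (induction t arbitrary: t' rule: sterm.induct)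
  case Leaf
  then show ?case by (metis internal_nodes_eq_Nil_iff)
next
  case (Node s ts)
  from Node.prems(4) obtain s' ts' where t': "t' = Node s' ts'" by (cases t') auto
  from Node.prems t' have s: "s' = s" "concat (map dc ts) = concat (map dc ts')" by auto
  have ts: "length ts = ar s" "\<forall>t\<in>set ts. t \<in> S_terms S ar"
    using Node.prems(1) by (simp_all add: Node_in_S_terms_iff)
  have ts': "length ts' = ar s" "\<forall>t\<in>set ts'. t \<in> S_terms S ar"
    using Node.prems(2) by (simp_all add: t' s Node_in_S_terms_iff)
  have child: "internal_nodes (us ! k) =
      map tl (filter (\<lambda>a. a \<noteq> [] \<and> hd a = Suc k) (internal_nodes (Node s us)))"
    if "k < length us" for k and us :: "'a sterm list"
    using that
  proof (induction us rule: rev_induct)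
    case (snoc u us)
    have 1: "filter (\<lambda>a. a \<noteq> [] \<and> hd a = Suc k) (map ((#) (Suc (length us))) (internal_nodes u)) =
        (if k = length us then map ((#) (Suc (length us))) (internal_nodes u) else [])"
      by (auto simp: filter_map comp_def)
    have 2: "filter (\<lambda>a. a \<noteq> [] \<and> hd a = Suc k) (internal_nodes (Node s us)) = []"
      if "k = length us"
      using that unfolding filter_empty_conv by (auto simp: in_internal_nodes_Node simp del: internal_nodes.simps)
    show ?case
      unfolding internal_nodes_snoc filter_append 1
      using snoc 2 by (auto simp: nth_append comp_def less_Suc_eq simp del: internal_nodes.simps)
  qed simp
  have nodes: "internal_nodes (ts ! k) = internal_nodes (ts' ! k)" if "k < ar s" for k
    using child[of k ts] child[of k ts'] that ts ts' Node.prems(4) t' s by simp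
  \<comment> \<open>Equal node counts in corresponding children fix where the concatenated
    decoration word is cut.\<close>
  then have "length (dc (ts ! k)) = length (dc (ts' ! k))" if "k < ar s" for k
    using that by (simp add: length_dc deg_def)
  then have "\<forall>(x, y)\<in>set (zip (map dc ts) (map dc ts')). length x = length y"
    using ts ts' by (auto simp: set_zip)
  then have "map dc ts = map dc ts'"
    using s(2) ts ts' by (simp add: concat_eq_concat_iff)
  then have "dc (ts ! k) = dc (ts' ! k)" if "k < ar s" for k
    using that ts ts' by (metis nth_map)
  then have "ts ! k = ts' ! k" if "k < ar s" for k
    using Node.IH[of "ts ! k" "ts' ! k"] nodes that ts ts' by auto
  then have "ts = ts'" using ts ts' by (intro nth_equalityI) auto
  then show ?case using t' s by simp
qed

text \<open>A parent has a smaller number than its child, so strong induction on numbers rebuilds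
  every address from that of the parent.\<close>

lemma sterm_eq_if_pa_lp_eq:
  assumes "t \<in> S_terms S ar" "t' \<in> S_terms S ar" "dc t = dc t'"
    and pa: "\<And>i. i \<in> {2..deg t} \<Longrightarrow> pa t i = pa t' i"
    and lp: "\<And>i. i \<in> {2..deg t} \<Longrightarrow> lp t i = lp t' i"
  shows "t = t'"
proof (rule sterm_eq_if_internal_nodes_eq[OF assms(1-3)])
  have deg: "deg t' = deg t" using length_dc assms(3) by metis
  have "addr t i = addr t' i" if "i \<in> {1..deg t}" for i
    using that
  proof (induction i rule: less_induct)
    case (less i)
    show ?case
    proof (cases "i = 1")
      case True
      then show ?thesis using less.prems deg addr_root by (metis atLeastAtMost_iff less_le_trans zero_less_one)
    next
      case False
      then have i: "i \<in> {2..deg t}" using less.prems by auto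
      then have "addr t (pa t i) = addr t' (pa t i)"
        using less.IH[OF pa_less[OF i]] addr_pa(1) by blast
      then show ?thesis
        using addr_pa(2)[OF i] addr_pa(2)[of i t'] i deg pa[OF i] lp[OF i] by simp
    qed
  qed
  from this[of "Suc k" for k] show "internal_nodes t = internal_nodes t'"
    using deg unfolding deg_def addr_def by (intro nth_equalityI) auto
qed

lemma wind_le_antisym:
  assumes t: "t \<in> S_terms S ar" and t': "t' \<in> S_terms S ar"
    and "wind_le ar t t'" "wind_le ar t' t"
  shows "t = t'"
proof -
  have dc: "dc t = dc t'" using assms(3) by (simp add: wind_le_def)
  then have deg: "deg t' = deg t" using length_dc by metis
  have "pa t i = pa t' i \<and> lp t i = lp t' i" if i: "i \<in> {2..deg t}" for i
  proof -
    have "pa t i < pa t' i \<or> pa t i = pa t' i \<and> lp t' i \<le> lp t i"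
      using assms(3) i unfolding wind_le_iff[OF t t'] by blast
    moreover have "pa t' i < pa t i \<or> pa t' i = pa t i \<and> lp t i \<le> lp t' i"
      using assms(4) i unfolding wind_le_iff[OF t' t] deg by blast
    ultimately show ?thesis by linarith
  qed
  then show ?thesis using sterm_eq_if_pa_lp_eq[OF t t' dc] by blast
qed

section \<open>Monotonicity of ranks and the closure operator\<close>

text \<open>If \<open>i\<close> has the same parent \<open>p\<close> in \<open>t \<preceq> t'\<close>, then each sibling \<open>j \<le> i\<close> of \<open>i\<close> in
  \<open>t'\<close> satisfies \<open>pa t j \<le> p\<close> by \<open>t \<preceq> t'\<close> and \<open>pa t j \<ge> p\<close> by the interval property.\<close>

lemma sibling_rank_antimono:
  assumes t: "t \<in> S_terms S ar" and t': "t' \<in> S_terms S ar" and le: "wind_le ar t t'"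
    and i: "i \<in> {2..deg t}" and eq: "pa t i = pa t' i"
  shows "sibling_rank t' i \<le> sibling_rank t i"
  unfolding sibling_rank_def
proof (rule card_mono)
  have deg: "deg t' = deg t" using le length_dc unfolding wind_le_def by metis
  show "{j \<in> {2..i}. pa t' j = pa t' i} \<subseteq> {j \<in> {2..i}. pa t j = pa t i}"
  proof
    fix j assume "j \<in> {j \<in> {2..i}. pa t' j = pa t' i}"
    then have j: "j \<in> {2..i}" "pa t' j = pa t' i" by auto
    have j2: "j \<in> {2..deg t}" using j i by auto
    have "pa t j \<le> pa t' j" using le j2 unfolding wind_le_iff[OF t t'] by force
    \<comment> \<open>Since \<open>pa t' j = pa t i\<close>, this is the strict lower bound on
      \<open>j\<close> that the interval property needs.\<close>
    moreover have "pa t' j < j" using pa_less j2 deg by metis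
    then have "pa t i \<le> pa t j" using pa_le_between[OF i] j eq by auto
    ultimately show "j \<in> {j \<in> {2..i}. pa t j = pa t i}" using j eq by auto
  qed
qed simp

theorem theorem2p3p3:
  fixes S :: "'s set" and ar :: "'s \<Rightarrow> nat" and X :: "nat set"
  assumes "\<forall>i\<in>X. 0 < i"
  shows "poset_on (S_terms S ar) (wind_le ar) \<and>
         closure_operator_on (S_terms S ar) (wind_le ar) (tlt X)"
proof -
  let ?T = "S_terms S ar" and ?le = "wind_le ar"
  have closed: "tlt X t \<in> ?T" if "t \<in> ?T" for t
    unfolding tlt_def using that by (rule tilt_at_in_S_terms)
  have dc_tlt: "dc (tlt X t) = dc t" for t :: "'s sterm"
    by (simp add: tlt_def dc_tilt_at)
  have "reflp_on ?T ?le" by (auto intro!: reflp_onI simp: wind_le_def)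
  moreover have "antisymp_on ?T ?le" by (rule antisymp_onI) (rule wind_le_antisym)
  moreover have "transp_on ?T ?le"
  proof (rule transp_onI)
    fix t u v assume "?le t u" "?le u v"
    moreover from this have "deg t = deg u" using length_dc unfolding wind_le_def by metis
    ultimately show "?le t v" unfolding wind_le_def by force
  qed
  moreover have "?le t (tlt X t)" if "t \<in> ?T" for t
    unfolding wind_le_iff[OF that closed[OF that]]
    by (auto simp: dc_tlt pa_lp_tlt sibling_rank_le_lp)
  moreover have "monotone_on ?T ?le ?le (tlt X)"
  proof (rule monotone_onI)
    fix t u assume t: "t \<in> ?T" and u: "u \<in> ?T" and le: "?le t u"
    then have deg: "deg t = deg u" using length_dc unfolding wind_le_def by metis
    show "?le (tlt X t) (tlt X u)"
      unfolding wind_le_iff[OF closed[OF t] closed[OF u]] dc_tlt deg_tlt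
    proof (intro conjI ballI)
      show "dc t = dc u" using le by (simp add: wind_le_def)
      fix i assume i: "i \<in> {2..deg t}"
      then have "pa t i < pa u i \<or> pa t i = pa u i \<and> lp u i \<le> lp t i"
        using le unfolding wind_le_iff[OF t u] by blast
      \<comment> \<open>A strictly smaller parent settles the comparison. Equal parents are both in
        \<open>X\<close> or both outside, so either two ranks or two original positions are
        compared.\<close>
      then show "pa (tlt X t) i < pa (tlt X u) i \<or>
          pa (tlt X t) i = pa (tlt X u) i \<and> lp (tlt X u) i \<le> lp (tlt X t) i"
        using sibling_rank_antimono[OF t u le i] i pa_lp_tlt[of i t X] pa_lp_tlt[of i u X] deg
        by auto
    qed
  qed
  \<comment> \<open>After one tilt a child of a node in \<open>X\<close> sits at its rank, and the
    rank is unchanged, so the second tilt gives the same position.\<close>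
  moreover have "tlt X (tlt X t) = tlt X t" if "t \<in> ?T" for t
    using that
    by (intro sterm_eq_if_pa_lp_eq[of _ S ar] closed)
      (auto simp: dc_tlt deg_tlt pa_lp_tlt sibling_rank_tlt)
  ultimately show ?thesis
    unfolding poset_on_def closure_operator_on_def using closed by blast
qed

end
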